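(* For $\alpha\in\mathbb R$ let $\Phi_\alpha:\mathcal M_3\to\mathcal M_3$ be the linear map $$\Phi_\alpha(X)=X+\sum_{i=2}^{9}\gamma_i\Big(G_iXG_i-\tfrac12(G_iG_iX+XG_iG_i)\Big),$$ with $\gamma_2=\gamma_4=\gamma_5=\gamma_7=\alpha$, $\gamma_3=\gamma_6=\gamma_8=-\alpha$, $\gamma_9=\alpha/3$; explicitly, $\Phi_\alpha(X)=(1-2\alpha)X+2\alpha X^{T}$. Then: (i) $\Phi_{1/2}$ is the transposition map on $\mathcal M_3$; (ii) $\Phi_\alpha$ is positive for $0\le\alpha\le\tfrac12$; (iii) $\Phi_\alpha$ is not completely positive for $\alpha\ge0$, and hence it is positive but not completely positive for $0\le\alpha\le\tfrac12$; (iv) $\Phi_\alpha$ is decomposable for $0\le\alpha\le\tfrac12$, and this class of maps cannot detect any PPT entangled states.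
   Context: $\mathcal M_3$ is the algebra of $3\times3$ complex matrices with matrix units $E_{jk}$, and $X^T$ is the transpose of $X$. The Gell-Mann matrices are numbered and normalized as follows: $G_2=E_{12}+E_{21}$, $G_3=-iE_{12}+iE_{21}$, $G_4=\mathrm{diag}(1,-1,0)$, $G_5=E_{13}+E_{31}$, $G_6=-iE_{13}+iE_{31}$, $G_7=E_{23}+E_{32}$, $G_8=-iE_{23}+iE_{32}$, $G_9=\mathrm{diag}(1,1,-2)$. A linear map on $\mathcal M_3$ is positive if it preserves positive semidefiniteness, completely positive if all its amplifications $\mathrm{id}_n\otimes\Phi$ are positive, completely co-positive if it is the composition of transposition with a completely positive map, and decomposable if it is the sum of a completely positive map and a completely co-positive map. A positive map $\Phi$ detects a bipartite entangled state $\rho$ if $(\mathrm{id}\otimes\Phi)(\rho)$ is not positive semidefinite. A PPT entangled state is an entangled state whose partial transpose is positive semidefinite.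
   Formalization: In (iii), "not completely positive" is proved for α > 0 and "positive but not completely positive" for 0 < α ≤ 1/2; the value α = 0 is excluded because Φ_0 is the identity map, which is completely positive. *)

theory Defs
  imports "Jordan_Normal_Form.VS_Connect"
begin

text \<open>Matrices are those of \<^typ>\<open>complex mat\<close>; the algebra of \<open>d \<times> d\<close> matrices is
  \<open>carrier_mat d d\<close>, with indices starting at 0. A map is only ever constrained by its values on the
  relevant carrier.\<close>

section \<open>Positive maps on matrix algebras\<close>

text \<open>The order on \<^typ>\<open>complex\<close> is that of \<^theory>\<open>HOL-Library.Complex_Order\<close>: \<open>0 \<le> z\<close> says that
  \<open>z\<close> is real and nonnegative. Hence a matrix satisfying this condition is automatically
  Hermitian.\<close>

definition psd :: "nat \<Rightarrow> complex mat \<Rightarrow> bool" where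
  "psd n A \<longleftrightarrow> A \<in> carrier_mat n n \<and> (\<forall>v \<in> carrier_vec n. 0 \<le> (A *\<^sub>v v) \<bullet>c v)"

abbreviation linear_mat_map :: "nat \<Rightarrow> (complex mat \<Rightarrow> complex mat) \<Rightarrow> bool" where
  "linear_mat_map d \<Phi> \<equiv>
     linear_map class_ring (module_mat TYPE(complex) d d) (module_mat TYPE(complex) d d) \<Phi>"

lemma linear_mat_map_iff:
  "linear_mat_map d \<Phi> \<longleftrightarrow>
     (\<forall>X \<in> carrier_mat d d. \<Phi> X \<in> carrier_mat d d) \<and>
     (\<forall>X \<in> carrier_mat d d. \<forall>Y \<in> carrier_mat d d. \<Phi> (X + Y) = \<Phi> X + \<Phi> Y) \<and>
     (\<forall>c. \<forall>X \<in> carrier_mat d d. \<Phi> (c \<cdot>\<^sub>m X) = c \<cdot>\<^sub>m \<Phi> X)"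
proof -
  interpret V: vectorspace "class_ring :: complex ring" "module_mat TYPE(complex) d d"
    by (rule matrix_vs)
  have "linear_mat_map d \<Phi> \<longleftrightarrow>
    \<Phi> \<in> LinearCombinations.module_hom class_ring (module_mat TYPE(complex) d d) (module_mat TYPE(complex) d d)"
    using V.vectorspace_axioms V.module_axioms
    by (auto simp: linear_map_def mod_hom_def mod_hom_axioms_def)
  then show ?thesis
    by (auto simp: LinearCombinations.module_hom_def module_mat_simps class_ring_simps Pi_iff)
qed

definition positive_map :: "nat \<Rightarrow> (complex mat \<Rightarrow> complex mat) \<Rightarrow> bool" where
  "positive_map d \<Phi> \<longleftrightarrow> linear_mat_map d \<Phi> \<and> (\<forall>X. psd d X \<longrightarrow> psd d (\<Phi> X))"

text \<open>The tensor product of an \<open>n \<times> n\<close> and a \<open>d \<times> d\<close> matrix algebra is the algebra of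
  \<open>n * d \<times> n * d\<close> matrices, seen as \<open>n \<times> n\<close> arrays of \<open>d \<times> d\<close> blocks; \<open>id_n \<otimes> \<Phi>\<close> applies \<open>\<Phi>\<close> to
  each block.\<close>

definition kron :: "complex mat \<Rightarrow> complex mat \<Rightarrow> complex mat" where
  "kron A B = mat (dim_row A * dim_row B) (dim_col A * dim_col B)
     (\<lambda>(r, c). A $$ (r div dim_row B, c div dim_col B) * B $$ (r mod dim_row B, c mod dim_col B))"

definition block :: "nat \<Rightarrow> complex mat \<Rightarrow> nat \<Rightarrow> nat \<Rightarrow> complex mat" where
  "block d A i j = mat d d (\<lambda>(a, b). A $$ (i * d + a, j * d + b))"

definition amplification ::
  "nat \<Rightarrow> nat \<Rightarrow> (complex mat \<Rightarrow> complex mat) \<Rightarrow> complex mat \<Rightarrow> complex mat" where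
  "amplification n d \<Phi> A =
     mat (n * d) (n * d) (\<lambda>(r, c). \<Phi> (block d A (r div d) (c div d)) $$ (r mod d, c mod d))"

lemma amplification_kron:
  assumes "linear_mat_map d \<Phi>" "A \<in> carrier_mat n n" "B \<in> carrier_mat d d"
  shows "amplification n d \<Phi> (kron A B) = kron A (\<Phi> B)"
proof (rule eq_matI)
  have \<Phi>B: "\<Phi> B \<in> carrier_mat d d" using assms by (auto simp: linear_mat_map_iff)
  then show "dim_row (amplification n d \<Phi> (kron A B)) = dim_row (kron A (\<Phi> B))"
    and "dim_col (amplification n d \<Phi> (kron A B)) = dim_col (kron A (\<Phi> B))"
    using assms by (auto simp: amplification_def kron_def)
  fix r c assume "r < dim_row (kron A (\<Phi> B))" "c < dim_col (kron A (\<Phi> B))"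
  then have rc: "r < n * d" "c < n * d" using assms \<Phi>B by (auto simp: kron_def)
  then have d: "d > 0" by (cases d) auto
  have lt: "i * d + a < n * d" if "i < n" "a < d" for i a
  proof -
    have "i * d + a < Suc i * d" using that by simp
    also have "\<dots> \<le> n * d" using that by (intro mult_le_mono1) simp
    finally show ?thesis .
  qed
  have dv: "r div d < n" "c div d < n" using rc by (auto simp: less_mult_imp_div_less)
  have "block d (kron A B) (r div d) (c div d) = A $$ (r div d, c div d) \<cdot>\<^sub>m B"
    using assms d dv lt by (intro eq_matI) (auto simp: block_def kron_def)
  then have "\<Phi> (block d (kron A B) (r div d) (c div d)) = A $$ (r div d, c div d) \<cdot>\<^sub>m \<Phi> B"
    using assms by (auto simp: linear_mat_map_iff)
  then show "amplification n d \<Phi> (kron A B) $$ (r, c) = kron A (\<Phi> B) $$ (r, c)"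
    using rc d \<Phi>B assms by (auto simp: amplification_def kron_def)
qed

definition completely_positive :: "nat \<Rightarrow> (complex mat \<Rightarrow> complex mat) \<Rightarrow> bool" where
  "completely_positive d \<Phi> \<longleftrightarrow>
     linear_mat_map d \<Phi> \<and> (\<forall>n \<ge> 1. positive_map (n * d) (amplification n d \<Phi>))"

definition completely_copositive :: "nat \<Rightarrow> (complex mat \<Rightarrow> complex mat) \<Rightarrow> bool" where
  "completely_copositive d \<Phi> \<longleftrightarrow>
     (\<exists>\<Psi>. completely_positive d \<Psi> \<and> (\<forall>X \<in> carrier_mat d d. \<Phi> X = \<Psi> (transpose_mat X)))"

definition decomposable :: "nat \<Rightarrow> (complex mat \<Rightarrow> complex mat) \<Rightarrow> bool" where
  "decomposable d \<Phi> \<longleftrightarrow>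
     (\<exists>\<Phi>\<^sub>1 \<Phi>\<^sub>2. completely_positive d \<Phi>\<^sub>1 \<and> completely_copositive d \<Phi>\<^sub>2 \<and>
        (\<forall>X \<in> carrier_mat d d. \<Phi> X = \<Phi>\<^sub>1 X + \<Phi>\<^sub>2 X))"

section \<open>Bipartite states\<close>

definition mat_sum :: "nat \<Rightarrow> nat \<Rightarrow> ('i \<Rightarrow> complex mat) \<Rightarrow> 'i set \<Rightarrow> complex mat" where
  "mat_sum nr nc F I = mat nr nc (\<lambda>(r, c). \<Sum>i \<in> I. F i $$ (r, c))"

definition state :: "nat \<Rightarrow> complex mat \<Rightarrow> bool" where
  "state n \<rho> \<longleftrightarrow> psd n \<rho> \<and> (\<Sum>i<n. \<rho> $$ (i, i)) = 1"

definition separable_state :: "nat \<Rightarrow> nat \<Rightarrow> complex mat \<Rightarrow> bool" where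
  "separable_state m d \<rho> \<longleftrightarrow>
     (\<exists>(N::nat) (p :: nat \<Rightarrow> real) A B.
        (\<forall>k<N. 0 \<le> p k \<and> state m (A k) \<and> state d (B k)) \<and> (\<Sum>k<N. p k) = 1 \<and>
        \<rho> = mat_sum (m * d) (m * d) (\<lambda>k. complex_of_real (p k) \<cdot>\<^sub>m kron (A k) (B k)) {..<N})"

definition entangled_state :: "nat \<Rightarrow> nat \<Rightarrow> complex mat \<Rightarrow> bool" where
  "entangled_state m d \<rho> \<longleftrightarrow> state (m * d) \<rho> \<and> \<not> separable_state m d \<rho>"

text \<open>Transposing the first factor instead gives the transpose of this matrix, so the choice of
  factor does not affect positive semidefiniteness.\<close>

definition partial_transpose :: "nat \<Rightarrow> nat \<Rightarrow> complex mat \<Rightarrow> complex mat" where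
  "partial_transpose m d \<rho> = amplification m d transpose_mat \<rho>"

definition ppt_entangled_state :: "nat \<Rightarrow> nat \<Rightarrow> complex mat \<Rightarrow> bool" where
  "ppt_entangled_state m d \<rho> \<longleftrightarrow>
     entangled_state m d \<rho> \<and> psd (m * d) (partial_transpose m d \<rho>)"

definition detects :: "nat \<Rightarrow> nat \<Rightarrow> (complex mat \<Rightarrow> complex mat) \<Rightarrow> complex mat \<Rightarrow> bool" where
  "detects m d \<Phi> \<rho> \<longleftrightarrow> \<not> psd (m * d) (amplification m d \<Phi> \<rho>)"

section \<open>The maps \<open>\<Phi>\<^sub>\<alpha>\<close>\<close>

text \<open>Only the indices 2 to 9 are meaningful in the next two definitions.\<close>

definition gell_mann :: "nat \<Rightarrow> complex mat" where
  "gell_mann i = mat_of_rows_list 3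
     (if i = 2 then [[0, 1, 0], [1, 0, 0], [0, 0, 0]]
      else if i = 3 then [[0, - \<i>, 0], [\<i>, 0, 0], [0, 0, 0]]
      else if i = 4 then [[1, 0, 0], [0, - 1, 0], [0, 0, 0]]
      else if i = 5 then [[0, 0, 1], [0, 0, 0], [1, 0, 0]]
      else if i = 6 then [[0, 0, - \<i>], [0, 0, 0], [\<i>, 0, 0]]
      else if i = 7 then [[0, 0, 0], [0, 0, 1], [0, 1, 0]]
      else if i = 8 then [[0, 0, 0], [0, 0, - \<i>], [0, \<i>, 0]]
      else [[1, 0, 0], [0, 1, 0], [0, 0, - 2]])"

definition gamma_coeff :: "real \<Rightarrow> nat \<Rightarrow> real" where
  "gamma_coeff \<alpha> i =
     (if i \<in> {2, 4, 5, 7} then \<alpha> else if i \<in> {3, 6, 8} then - \<alpha> else \<alpha> / 3)"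

definition Phi :: "real \<Rightarrow> complex mat \<Rightarrow> complex mat" where
  "Phi \<alpha> X = X + mat_sum 3 3
     (\<lambda>i. let G = gell_mann i in
        complex_of_real (gamma_coeff \<alpha> i) \<cdot>\<^sub>m
          (G * X * G - (1 / 2) \<cdot>\<^sub>m (G * G * X + X * G * G))) {2..9}"

text \<open>At \<open>\<alpha> = 0\<close> the map is the identity, hence completely positive; any claim that \<open>\<Phi>\<^sub>\<alpha>\<close> is not
  completely positive has to exclude this value.\<close>

lemma Phi_0:
  assumes "X \<in> carrier_mat 3 3"
  shows "Phi 0 X = X"
proof -
  have G: "gell_mann i \<in> carrier_mat 3 3" for i
    by (auto simp: gell_mann_def mat_of_rows_list_def numeral_3_eq_3)
  have "mat_sum 3 3
     (\<lambda>i. let G = gell_mann i in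
        complex_of_real (gamma_coeff 0 i) \<cdot>\<^sub>m
          (G * X * G - (1 / 2) \<cdot>\<^sub>m (G * G * X + X * G * G))) {2..9} = 0\<^sub>m 3 3"
  proof (rule eq_matI)
    fix r c :: nat assume "r < dim_row (0\<^sub>m 3 3 :: complex mat)" "c < dim_col (0\<^sub>m 3 3 :: complex mat)"
    then have rc: "r < 3" "c < 3" by auto
    have dG: "dim_row (gell_mann i) = 3" "dim_col (gell_mann i) = 3" for i using G[of i] by auto
    show "mat_sum 3 3
     (\<lambda>i. let G = gell_mann i in
        complex_of_real (gamma_coeff 0 i) \<cdot>\<^sub>m
          (G * X * G - (1 / 2) \<cdot>\<^sub>m (G * G * X + X * G * G))) {2..9} $$ (r, c) = 0\<^sub>m 3 3 $$ (r, c)"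
      using rc assms dG
      by (auto simp: mat_sum_def Let_def gamma_coeff_def)
  qed (auto simp: mat_sum_def)
  then show ?thesis using assms by (simp add: Phi_def)
qed

lemma completely_positive_Phi_0: "completely_positive 3 (Phi 0)"
proof -
  have amp: "amplification n 3 (Phi 0) A = A" if A: "A \<in> carrier_mat (n * 3) (n * 3)" for n A
  proof (rule eq_matI)
    fix r c assume "r < dim_row A" "c < dim_col A"
    then have rc: "r < n * 3" "c < n * 3" using A by auto
    have "block 3 A (r div 3) (c div 3) \<in> carrier_mat 3 3" by (simp add: block_def)
    then show "amplification n 3 (Phi 0) A $$ (r, c) = A $$ (r, c)"
      using rc by (simp add: amplification_def Phi_0 block_def)
  qed (use A in \<open>auto simp: amplification_def\<close>)
  have "linear_mat_map 3 (Phi 0)"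
    by (simp add: linear_mat_map_iff Phi_0)
  moreover have "positive_map (n * 3) (amplification n 3 (Phi 0))" for n
    by (auto simp: positive_map_def linear_mat_map_iff amp psd_def)
  ultimately show ?thesis by (simp add: completely_positive_def)
qed

end

(* Entrywise, Phi alpha is the convex combination (1 - 2 alpha) id + 2 alpha T of the identity and the
   transposition T: the Gell-Mann matrices with coefficient alpha and those with coefficient -alpha
   cancel except for the transposed off-diagonal entry, and the diagonal ones only damp the
   off-diagonal entries. This gives decomposability, and a state with positive partial transpose is
   mapped to a nonnegative combination of itself and its partial transpose. Complete positivity fails
   on the two-qubit maximally entangled vector: the antisymmetric vector has expectation -4 alpha. *)
theory Submission
  imports Defs
begin

lemma psd_add:
  assumes "psd n A" "psd n B"
  shows "psd n (A + B)"
proof -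
  have "((A + B) *\<^sub>v v) \<bullet>c v = (A *\<^sub>v v) \<bullet>c v + (B *\<^sub>v v) \<bullet>c v" if "v \<in> carrier_vec n" for v
    using assms that
    by (auto simp: psd_def add_mult_distrib_mat_vec[of _ n n] intro!: add_scalar_prod_distrib[of _ n])
  then show ?thesis
    using assms by (simp add: psd_def)
qed

lemma psd_smult:
  assumes "psd n A" "0 \<le> c"
  shows "psd n (complex_of_real c \<cdot>\<^sub>m A)"
proof -
  have "((complex_of_real c \<cdot>\<^sub>m A) *\<^sub>v v) \<bullet>c v = complex_of_real c * ((A *\<^sub>v v) \<bullet>c v)"
    if "v \<in> carrier_vec n" for v
  proof -
    have "(complex_of_real c \<cdot>\<^sub>m A) *\<^sub>v v = complex_of_real c \<cdot>\<^sub>v (A *\<^sub>v v)"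
      using assms that by (intro eq_vecI) (auto simp: psd_def)
    then show ?thesis using assms that by (auto simp: psd_def)
  qed
  then show ?thesis
    using assms by (auto simp: psd_def less_eq_complex_def)
qed

text \<open>The double sum lets the order of summation be swapped for the transpose, and lets the
  form be evaluated entry by entry in dimension 6.\<close>

lemma quadratic_form_eq_sum:
  fixes A :: "complex mat"
  assumes "A \<in> carrier_mat n n" "v \<in> carrier_vec n"
  shows "(A *\<^sub>v v) \<bullet>c v = (\<Sum>i<n. \<Sum>j<n. A $$ (i, j) * v $ j * cnj (v $ i))"
  using assms by (simp add: scalar_prod_def sum_distrib_right lessThan_atLeast0)

text \<open>Swapping the two sums moves the transposition onto the vector: the form of the transpose
  at \<open>v\<close> is the form of \<open>A\<close> at \<open>conjugate v\<close>.\<close>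

lemma psd_transpose:
  assumes "psd n A"
  shows "psd n (transpose_mat A)"
proof -
  have A: "A \<in> carrier_mat n n" using assms by (simp add: psd_def)
  have "(transpose_mat A *\<^sub>v v) \<bullet>c v = (A *\<^sub>v conjugate v) \<bullet>c conjugate v"
    if v: "v \<in> carrier_vec n" for v
  proof -
    have "(transpose_mat A *\<^sub>v v) \<bullet>c v = (\<Sum>i<n. \<Sum>j<n. A $$ (j, i) * v $ j * cnj (v $ i))"
      using A v by (simp add: quadratic_form_eq_sum[of _ n])
    also have "\<dots> = (\<Sum>j<n. \<Sum>i<n. A $$ (j, i) * v $ j * cnj (v $ i))"
      by (rule sum.swap)
    also have "\<dots> = (A *\<^sub>v conjugate v) \<bullet>c conjugate v"
      using A v by (subst quadratic_form_eq_sum[of _ n]) (auto intro!: sum.cong)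
    finally show ?thesis .
  qed
  moreover have "0 \<le> (A *\<^sub>v conjugate v) \<bullet>c conjugate v" if "v \<in> carrier_vec n" for v
    using assms that carrier_vec_conjugate[OF that] unfolding psd_def by blast
  ultimately show ?thesis
    using A by (simp add: psd_def)
qed

lemma amplification_carrier: "amplification n d \<Phi> A \<in> carrier_mat (n * d) (n * d)"
  by (simp add: amplification_def)

text \<open>An amplification evaluates \<open>\<Phi>\<close> only on blocks, and these lie in
  \<open>carrier_mat d d\<close>, so a formula for \<open>\<Phi>\<close> on that carrier can be
  applied block by block.\<close>

lemma amplification_add_smult:
  assumes "A \<in> carrier_mat (n * d) (n * d)"
    and "\<And>X. X \<in> carrier_mat d d \<Longrightarrow> \<Phi> X = a \<cdot>\<^sub>m X + b \<cdot>\<^sub>m transpose_mat X"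
  shows "amplification n d \<Phi> A = a \<cdot>\<^sub>m A + b \<cdot>\<^sub>m partial_transpose n d A"
proof (rule eq_matI)
  fix r c assume "r < dim_row (a \<cdot>\<^sub>m A + b \<cdot>\<^sub>m partial_transpose n d A)"
    "c < dim_col (a \<cdot>\<^sub>m A + b \<cdot>\<^sub>m partial_transpose n d A)"
  then have rc: "r < n * d" "c < n * d"
    by (auto simp: partial_transpose_def amplification_def)
  \<comment> \<open>For \<open>d = 0\<close> there is no index \<open>r < n * d\<close>; positivity
    of \<open>d\<close> keeps the remainders modulo \<open>d\<close> inside a block.\<close>
  then have "0 < d" by (cases d) auto
  then have "r mod d < d" "c mod d < d" by auto
  moreover have "block d A i j \<in> carrier_mat d d" for i j by (simp add: block_def)
  ultimately show "amplification n d \<Phi> A $$ (r, c) = (a \<cdot>\<^sub>m A + b \<cdot>\<^sub>m partial_transpose n d A) $$ (r, c)"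
    using rc assms by (auto simp: amplification_def partial_transpose_def block_def)
qed (simp_all add: amplification_def partial_transpose_def)

lemma completely_positive_smult:
  assumes "0 \<le> c"
  shows "completely_positive d (\<lambda>X. complex_of_real c \<cdot>\<^sub>m X)"
proof -
  have amp: "amplification n d (\<lambda>X. complex_of_real c \<cdot>\<^sub>m X) A = complex_of_real c \<cdot>\<^sub>m A"
    if A: "A \<in> carrier_mat (n * d) (n * d)" for n A
  proof -
    \<comment> \<open>Scalar multiplication is the case \<open>b = 0\<close> of the blockwise
      formula.\<close>
    have "amplification n d (\<lambda>X. complex_of_real c \<cdot>\<^sub>m X) A
        = complex_of_real c \<cdot>\<^sub>m A + 0 \<cdot>\<^sub>m partial_transpose n d A"
      using A by (intro amplification_add_smult) auto
    also have "\<dots> = complex_of_real c \<cdot>\<^sub>m A"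
      using A by (intro eq_matI) (auto simp: partial_transpose_def amplification_def)
    finally show ?thesis .
  qed
  \<comment> \<open>Needed in dimension \<open>d\<close> for the map and in dimension
    \<open>n * d\<close> for its amplification, which is again multiplication by
    \<open>c\<close>.\<close>
  have lin: "linear_mat_map k (\<lambda>X. complex_of_real c \<cdot>\<^sub>m X)" for k
    by (auto simp: linear_mat_map_iff intro!: eq_matI add_smult_distrib_left_mat)
  have "linear_mat_map (n * d) (amplification n d (\<lambda>X. complex_of_real c \<cdot>\<^sub>m X))" for n
    using lin[of "n * d"] by (simp add: linear_mat_map_iff amp)
  moreover have "psd (n * d) (amplification n d (\<lambda>X. complex_of_real c \<cdot>\<^sub>m X) A)"
    if "psd (n * d) A" for n A
  proof -
    have "A \<in> carrier_mat (n * d) (n * d)" using that by (simp add: psd_def)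
    then show ?thesis using psd_smult[OF that assms] by (simp add: amp)
  qed
  ultimately show ?thesis
    using lin by (simp add: completely_positive_def positive_map_def)
qed

lemma gell_mann_carrier: "gell_mann i \<in> carrier_mat 3 3"
  by (auto simp: gell_mann_def mat_of_rows_list_def numeral_3_eq_3)

lemma less_3_cases: "r < 3 \<Longrightarrow> r = 0 \<or> r = 1 \<or> r = (2::nat)"
  by auto

text \<open>The two Gell-Mann matrices of an off-diagonal pair have equal squares and opposite
  coefficients. Their anticommutator terms cancel, and the difference of the terms
  \<open>G * X * G\<close> leaves the two off-diagonal entries, transposed and doubled. A diagonal
  \<open>G\<close> with entries d_j contributes -(d_j - d_k)^2 / 2 times entry (j, k); the weights
  \<alpha> and \<alpha>/3 make the total factor -2 \<alpha> for all j \<noteq> k.\<close>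

lemma Phi_eq:
  assumes X: "X \<in> carrier_mat 3 3"
  shows "Phi \<alpha> X = complex_of_real (1 - 2 * \<alpha>) \<cdot>\<^sub>m X + complex_of_real (2 * \<alpha>) \<cdot>\<^sub>m transpose_mat X"
proof (rule eq_matI)
  have dG: "dim_row (gell_mann i) = 3" "dim_col (gell_mann i) = 3" for i
    using gell_mann_carrier[of i] by auto
  have dX: "dim_row X = 3" "dim_col X = 3" using X by auto
  have ev: "{0..<3} = {0, 1, 2::nat}" "{2..9} = {2, 3, 4, 5, 6, 7, 8, 9::nat}" by auto
  \<comment> \<open>Used in place of \<open>index_mult_mat(1)\<close>, so that nested products
    unfold to polynomials in the entries of \<open>X\<close> instead of scalar products of rows and
    columns.\<close>
  have mult3: "(A * B) $$ (r, c)
      = A $$ (r, 0) * B $$ (0, c) + A $$ (r, 1) * B $$ (1, c) + A $$ (r, 2) * B $$ (2, c)"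
    if "dim_col A = 3" "dim_row B = 3" "r < dim_row A" "c < dim_col B"
    for A B :: "complex mat" and r c
    using that by (simp add: scalar_prod_def ev)
  fix r c assume "r < dim_row (complex_of_real (1 - 2 * \<alpha>) \<cdot>\<^sub>m X + complex_of_real (2 * \<alpha>) \<cdot>\<^sub>m transpose_mat X)"
    "c < dim_col (complex_of_real (1 - 2 * \<alpha>) \<cdot>\<^sub>m X + complex_of_real (2 * \<alpha>) \<cdot>\<^sub>m transpose_mat X)"
  then have rc: "r < 3" "c < 3" using dX by auto
  have "Phi \<alpha> X $$ (r, c) = X $$ (r, c) + (\<Sum>i\<in>{2..9}. complex_of_real (gamma_coeff \<alpha> i) *
      ((gell_mann i * X * gell_mann i) $$ (r, c) -
       1 / 2 * ((gell_mann i * gell_mann i * X) $$ (r, c) + (X * gell_mann i * gell_mann i) $$ (r, c))))"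
    using rc dX dG by (simp add: Phi_def mat_sum_def Let_def del: index_mult_mat(1))
  also have "\<dots> = complex_of_real (1 - 2 * \<alpha>) * X $$ (r, c) + complex_of_real (2 * \<alpha>) * X $$ (c, r)"
    \<comment> \<open>The nine entries are checked one by one.\<close>
    using less_3_cases[OF rc(1)] less_3_cases[OF rc(2)]
    by (elim disjE) (simp_all add: ev mult3 dX dG del: index_mult_mat(1),
      simp_all add: gell_mann_def gamma_coeff_def mat_of_rows_list_def field_simps)
  finally show "Phi \<alpha> X $$ (r, c)
      = (complex_of_real (1 - 2 * \<alpha>) \<cdot>\<^sub>m X + complex_of_real (2 * \<alpha>) \<cdot>\<^sub>m transpose_mat X) $$ (r, c)"
    using rc dX by simp
qed (use X in \<open>auto simp: Phi_def mat_sum_def\<close>)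

lemma linear_mat_map_Phi: "linear_mat_map 3 (Phi \<alpha>)"
  unfolding linear_mat_map_iff
  by (auto simp: Phi_eq intro!: eq_matI) (auto simp: algebra_simps)

lemma amplification_Phi:
  assumes "A \<in> carrier_mat (m * 3) (m * 3)"
  shows "amplification m 3 (Phi \<alpha>) A
    = complex_of_real (1 - 2 * \<alpha>) \<cdot>\<^sub>m A + complex_of_real (2 * \<alpha>) \<cdot>\<^sub>m partial_transpose m 3 A"
  using assms by (intro amplification_add_smult Phi_eq)

lemma positive_map_Phi:
  assumes "0 \<le> \<alpha>" "\<alpha> \<le> 1 / 2"
  shows "positive_map 3 (Phi \<alpha>)"
proof -
  have "psd 3 (Phi \<alpha> X)" if "psd 3 X" for X
  proof -
    have "X \<in> carrier_mat 3 3" using that by (simp add: psd_def)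
    moreover have "psd 3 (complex_of_real (1 - 2 * \<alpha>) \<cdot>\<^sub>m X + complex_of_real (2 * \<alpha>) \<cdot>\<^sub>m transpose_mat X)"
      using assms that by (intro psd_add psd_smult psd_transpose) auto
    ultimately show ?thesis by (simp add: Phi_eq)
  qed
  then show ?thesis by (simp add: positive_map_def linear_mat_map_Phi)
qed

lemma not_completely_positive_Phi:
  assumes "0 < \<alpha>"
  shows "\<not> completely_positive 3 (Phi \<alpha>)"
proof
  assume "completely_positive 3 (Phi \<alpha>)"
  \<comment> \<open>The second amplification already fails to be positive.\<close>
  then have pos: "positive_map (2 * 3) (amplification 2 3 (Phi \<alpha>))"
    unfolding completely_positive_def by (metis one_le_numeral)
  \<comment> \<open>The unnormalized projection onto \<open>e\<^sub>0 \<otimes> e\<^sub>0 + e\<^sub>1 \<otimes> e\<^sub>1\<close>, whose support is \<open>{0, 4}\<close>.\<close>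
  define A :: "complex mat" where
    "A = mat 6 6 (\<lambda>(i, j). if i \<in> {0, 4} \<and> j \<in> {0, 4} then 1 else 0)"
  \<comment> \<open>The antisymmetric vector \<open>e\<^sub>0 \<otimes> e\<^sub>1 - e\<^sub>1 \<otimes> e\<^sub>0\<close>.\<close>
  define w :: "complex vec" where "w = vec 6 (\<lambda>i. if i = 1 then 1 else if i = 3 then - 1 else 0)"
  have A: "A \<in> carrier_mat 6 6" and w: "w \<in> carrier_vec 6" by (auto simp: A_def w_def)
  have ev: "{..<6} = {0, 1, 2, 3, 4, 5::nat}" by auto
  have "0 \<le> (A *\<^sub>v v) \<bullet>c v" if "v \<in> carrier_vec 6" for v
  proof -
    have "(A *\<^sub>v v) \<bullet>c v = (v $ 0 + v $ 4) * cnj (v $ 0 + v $ 4)"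
      using that A by (simp add: quadratic_form_eq_sum[of _ 6] ev A_def algebra_simps)
    then show ?thesis by (simp only: complex_norm_square[symmetric]) (simp add: less_eq_complex_def flip: of_real_power)
  qed
  then have "psd (2 * 3) A" using A by (simp add: psd_def)
  then have "psd (2 * 3) (amplification 2 3 (Phi \<alpha>) A)"
    using pos by (simp add: positive_map_def)
  then have "0 \<le> (amplification 2 3 (Phi \<alpha>) A *\<^sub>v w) \<bullet>c w"
    using w by (simp add: psd_def)
  \<comment> \<open>\<open>A\<close> contributes 0, since \<open>w\<close> vanishes at 0 and 4.
    Partial transposition moves the ones at (0, 4) and (4, 0) to (1, 3) and (3, 1), where
    \<open>w\<close> gives -2, and the weight of this term is 2 \<alpha>.\<close>
  moreover have "(amplification 2 3 (Phi \<alpha>) A *\<^sub>v w) \<bullet>c w = complex_of_real (- 4 * \<alpha>)"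
  proof -
    have "amplification 2 3 (Phi \<alpha>) A \<in> carrier_mat 6 6"
      using amplification_carrier[of 2 3] by simp
    then show ?thesis
      using w A
      by (simp add: quadratic_form_eq_sum[of _ 6] ev w_def amplification_Phi)
        (simp add: A_def partial_transpose_def amplification_def block_def)
  qed
  ultimately have "0 \<le> complex_of_real (- 4 * \<alpha>)" by simp
  then have "0 \<le> - 4 * \<alpha>" by (simp add: less_eq_complex_def)
  then show False using assms by simp
qed

text \<open>The two terms of \<open>Phi_eq\<close> are the witnesses: \<alpha> \<le> 1/2 makes the
  first coefficient nonnegative, 0 \<le> \<alpha> the second.\<close>

lemma decomposable_Phi:
  assumes "0 \<le> \<alpha>" "\<alpha> \<le> 1 / 2"
  shows "decomposable 3 (Phi \<alpha>)"
proof -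
  have "completely_positive 3 (\<lambda>X. complex_of_real (1 - 2 * \<alpha>) \<cdot>\<^sub>m X)"
    using assms by (intro completely_positive_smult) simp
  moreover have "completely_positive 3 (\<lambda>X. complex_of_real (2 * \<alpha>) \<cdot>\<^sub>m X)"
    using assms by (intro completely_positive_smult) simp
  then have "completely_copositive 3 (\<lambda>X. complex_of_real (2 * \<alpha>) \<cdot>\<^sub>m transpose_mat X)"
    unfolding completely_copositive_def by blast
  ultimately show ?thesis
    unfolding decomposable_def using Phi_eq by blast
qed

lemma not_detects_Phi:
  assumes "0 \<le> \<alpha>" "\<alpha> \<le> 1 / 2" and "psd (m * 3) \<rho>" "psd (m * 3) (partial_transpose m 3 \<rho>)"
  shows "\<not> detects m 3 (Phi \<alpha>) \<rho>"
proof -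
  have "\<rho> \<in> carrier_mat (m * 3) (m * 3)" using assms by (simp add: psd_def)
  moreover have "psd (m * 3)
      (complex_of_real (1 - 2 * \<alpha>) \<cdot>\<^sub>m \<rho> + complex_of_real (2 * \<alpha>) \<cdot>\<^sub>m partial_transpose m 3 \<rho>)"
    using assms by (intro psd_add psd_smult) auto
  ultimately show ?thesis by (simp add: detects_def amplification_Phi)
qed

theorem mainTheorem5:
  shows "(\<forall>\<alpha>::real. linear_mat_map 3 (Phi \<alpha>) \<and>
            (\<forall>X \<in> carrier_mat 3 3. Phi \<alpha> X =
               complex_of_real (1 - 2 * \<alpha>) \<cdot>\<^sub>m X + complex_of_real (2 * \<alpha>) \<cdot>\<^sub>m transpose_mat X)) \<and>
         (\<forall>X \<in> carrier_mat 3 3. Phi (1 / 2) X = transpose_mat X) \<and>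
         (\<forall>\<alpha>::real. 0 \<le> \<alpha> \<and> \<alpha> \<le> 1 / 2 \<longrightarrow> positive_map 3 (Phi \<alpha>)) \<and>
         (\<forall>\<alpha>::real. 0 < \<alpha> \<longrightarrow> \<not> completely_positive 3 (Phi \<alpha>)) \<and>
         (\<forall>\<alpha>::real. 0 < \<alpha> \<and> \<alpha> \<le> 1 / 2 \<longrightarrow>
            positive_map 3 (Phi \<alpha>) \<and> \<not> completely_positive 3 (Phi \<alpha>)) \<and>
         (\<forall>\<alpha>::real. 0 \<le> \<alpha> \<and> \<alpha> \<le> 1 / 2 \<longrightarrow>
            decomposable 3 (Phi \<alpha>) \<and>
            (\<forall>m \<rho>. m \<ge> 1 \<and> ppt_entangled_state m 3 \<rho> \<longrightarrow> \<not> detects m 3 (Phi \<alpha>) \<rho>))"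
proof -
  have "Phi (1 / 2) X = transpose_mat X" if "X \<in> carrier_mat 3 3" for X
    using that by (auto simp: Phi_eq intro!: eq_matI)
  \<comment> \<open>These are the two positivity hypotheses of
    \<open>not_detects_Phi\<close>.\<close>
  moreover have "psd (m * 3) \<rho> \<and> psd (m * 3) (partial_transpose m 3 \<rho>)"
    if "ppt_entangled_state m 3 \<rho>" for m \<rho>
    using that by (simp add: ppt_entangled_state_def entangled_state_def state_def)
  ultimately show ?thesis
    using linear_mat_map_Phi Phi_eq positive_map_Phi not_completely_positive_Phi decomposable_Phi
      not_detects_Phi
    by auto
qed

end
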